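(* Consider the scaled exchangeable graph model $p_{ij}=\rho_nf(\xi_i,\xi_j)$, $\xi_1,\dots,\xi_n$ iid $\mathrm{Uniform}(0,1)$, described in the context. Assume: 1. The graphon $f$ is a positive, symmetric function on $(0,1)^2$, and is $\alpha$-Hölder continuous, $0<\alpha\le1$; 2. Furthermore, $f$ is bounded away from zero and $\max_n\rho_nf$ is bounded away from unity; 3. Each set $\mathcal Z_k(n)\subseteq\{1,\dots,k\}^n$ of admissible blockmodel assignments has the following property: if $H$ is generated by some $z\in\mathcal Z_k$, then $H^{-1}\circ\Pi\in\mathcal Z_k$ for every permutation $\Pi$ of $\{1,\dots,n\}$. Then, for $h_\vee=h_\vee(n)$ the largest community size in each $\mathcal Z_k(n)$, $$\frac{\min_{z\in\mathcal Z_k}\sum_{i<j}D(p_{ij}\|\bar p_{z_iz_j})}{\sum_{i<j}p_{ij}}=\mathcal O_P\bigl(n^{-\alpha}+(n/h_\vee)^{-2\alpha}\bigr).$$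
   Context: Model: $f$ is a bounded nonnegative symmetric measurable function on $(0,1)^2$ with $\iint f\,dx\,dy=1$; $\rho_n>0$ is a fixed monotone non-increasing sequence; $\xi_1,\dots,\xi_n$ are iid Uniform$(0,1)$ and $p_{ij}=\rho_nf(\xi_i,\xi_j)$. $\alpha$-Hölder means $|f(x,y)-f(x',y')|\le M|(x,y)-(x',y')|^\alpha$ on $(0,1)^2$ for some $M<\infty$ (Euclidean norm). A community size vector $h\in\{2,\dots,n\}^k$, $\sum_{a=1}^kh_a=n$, defines $H(u)=\frac1n\sum_{a=1}^{\lfloor u\rfloor}h_a$ for $u\in[0,k]$ and $H^{-1}(x)=\inf\{u\in[0,k]:H(u)\ge x\}$ for $x\in(0,1]$. An assignment $z\in\{1,\dots,k\}^n$ with community sizes $h_a=|z^{-1}(a)|$ generates the corresponding $H$, and can be written $z_i=H^{-1}\{\Pi_z(i)/n\}$ for some permutation $\Pi_z$; $H^{-1}\circ\Pi$ denotes the assignment $i\mapsto H^{-1}\{\Pi(i)/n\}$. All admissible assignments have community sizes at least 2. Here $k=k(n)$. $\bar p_{ab}=\bar p(z)_{ab}$ is the average of $p_{ij}$ over $i\in z^{-1}(a)$, $j\in z^{-1}(b)$ (over pairs $i<j$ in $z^{-1}(a)$ when $a=b$). $D(p\|p')=p\log(p/p')+(1-p)\log\{(1-p)/(1-p')\}$. *)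

theory Defs
  imports "HOL-Probability.Probability" "HOL-Combinatorics.Permutations"
begin

abbreviation open_unit_square :: "(real \<times> real) set" where
  "open_unit_square \<equiv> {0<..<1} \<times> {0<..<1}"

text \<open>Vertices are \<open>1, \<dots>, n\<close> and communities are \<open>1, \<dots>, k\<close>. The graphon is only constrained on
  the open unit square, and the latent variables take their values in the open unit interval
  everywhere (not just almost surely), so that the values of \<open>f\<close> elsewhere are irrelevant.\<close>

locale scaled_exchangeable_graph = prob_space M
  for M :: "'a measure" +
  fixes f :: "real \<times> real \<Rightarrow> real"
    and \<rho> :: "nat \<Rightarrow> real"
    and \<xi> :: "nat \<Rightarrow> 'a \<Rightarrow> real"
  assumes graphon_measurable: "f \<in> borel_measurable (restrict_space borel open_unit_square)"
    and graphon_nonneg: "\<And>v. v \<in> open_unit_square \<Longrightarrow> 0 \<le> f v"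
    and graphon_bounded: "bounded (f ` open_unit_square)"
    and graphon_symmetric:
      "\<And>x y. x \<in> {0<..<1} \<Longrightarrow> y \<in> {0<..<1} \<Longrightarrow> f (x, y) = f (y, x)"
    and graphon_integral: "(LINT v:open_unit_square|lborel. f v) = 1"
    and scale_pos: "\<And>n. 1 \<le> n \<Longrightarrow> 0 < \<rho> n"
    and scale_noninc: "\<And>m n. 1 \<le> m \<Longrightarrow> m \<le> n \<Longrightarrow> \<rho> n \<le> \<rho> m"
    and latent_range: "\<And>i \<omega>. 1 \<le> i \<Longrightarrow> \<omega> \<in> space M \<Longrightarrow> \<xi> i \<omega> \<in> {0<..<1}"
    and latent_indep: "indep_vars (\<lambda>_. borel) \<xi> {1..}"
    and latent_uniform:
      "\<And>i. 1 \<le> i \<Longrightarrow> distr M borel (\<xi> i) = uniform_measure lborel {0<..<1}"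

definition edge_prob ::
  "(real \<times> real \<Rightarrow> real) \<Rightarrow> (nat \<Rightarrow> real) \<Rightarrow> (nat \<Rightarrow> 'a \<Rightarrow> real) \<Rightarrow> nat \<Rightarrow> 'a \<Rightarrow> nat \<Rightarrow> nat \<Rightarrow> real"
  where "edge_prob f \<rho> \<xi> n \<omega> i j = \<rho> n * f (\<xi> i \<omega>, \<xi> j \<omega>)"

definition holder_on :: "real \<Rightarrow> 'a::metric_space set \<Rightarrow> ('a \<Rightarrow> real) \<Rightarrow> bool" where
  "holder_on \<alpha> S f \<longleftrightarrow> (\<exists>L. \<forall>u\<in>S. \<forall>v\<in>S. \<bar>f u - f v\<bar> \<le> L * dist u v powr \<alpha>)"

definition vertex_pairs :: "nat \<Rightarrow> (nat \<times> nat) set" where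
  "vertex_pairs n = {(i, j). 1 \<le> i \<and> i < j \<and> j \<le> n}"

definition community :: "nat \<Rightarrow> (nat \<Rightarrow> nat) \<Rightarrow> nat \<Rightarrow> nat set" where
  "community n z a = {i \<in> {1..n}. z i = a}"

definition community_size :: "nat \<Rightarrow> (nat \<Rightarrow> nat) \<Rightarrow> nat \<Rightarrow> nat" where
  "community_size n z a = card (community n z a)"

definition assignments :: "nat \<Rightarrow> nat \<Rightarrow> (nat \<Rightarrow> nat) set" where
  "assignments n k = {z \<in> {1..n} \<rightarrow>\<^sub>E {1..k}. \<forall>a\<in>{1..k}. 2 \<le> community_size n z a}"

definition cumulative_size :: "nat \<Rightarrow> (nat \<Rightarrow> nat) \<Rightarrow> real \<Rightarrow> real" where
  "cumulative_size n h u = 1 / real n * (\<Sum>a = 1..nat \<lfloor>u\<rfloor>. real (h a))"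

definition cumulative_size_inv :: "nat \<Rightarrow> nat \<Rightarrow> (nat \<Rightarrow> nat) \<Rightarrow> real \<Rightarrow> real" where
  "cumulative_size_inv n k h x = Inf {u \<in> {0..real k}. x \<le> cumulative_size n h u}"

text \<open>For \<open>h\<close> with \<open>h 1 + \<dots> + h k = n\<close>, the real-valued generalised inverse takes values in
  \<open>{1..k}\<close> on \<open>(0, 1]\<close>; the floor below only converts these to type \<^typ>\<open>nat\<close>.\<close>

definition permuted_assignment ::
  "nat \<Rightarrow> nat \<Rightarrow> (nat \<Rightarrow> nat) \<Rightarrow> (nat \<Rightarrow> nat) \<Rightarrow> nat \<Rightarrow> nat" where
  "permuted_assignment n k h \<pi> =
     (\<lambda>i\<in>{1..n}. nat \<lfloor>cumulative_size_inv n k h (real (\<pi> i) / real n)\<rfloor>)"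

definition block_pairs :: "nat \<Rightarrow> (nat \<Rightarrow> nat) \<Rightarrow> nat \<Rightarrow> nat \<Rightarrow> (nat \<times> nat) set" where
  "block_pairs n z a b =
     (if a = b then {(i, j) \<in> community n z a \<times> community n z a. i < j}
      else community n z a \<times> community n z b)"

definition block_average ::
  "nat \<Rightarrow> (nat \<Rightarrow> nat) \<Rightarrow> (nat \<Rightarrow> nat \<Rightarrow> real) \<Rightarrow> nat \<Rightarrow> nat \<Rightarrow> real" where
  "block_average n z p a b =
     (\<Sum>(i, j)\<in>block_pairs n z a b. p i j) / real (card (block_pairs n z a b))"

definition bernoulli_KL :: "real \<Rightarrow> real \<Rightarrow> real" where
  "bernoulli_KL p q = p * ln (p / q) + (1 - p) * ln ((1 - p) / (1 - q))"

definition blockmodel_divergence ::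
  "nat \<Rightarrow> (nat \<Rightarrow> nat \<Rightarrow> real) \<Rightarrow> (nat \<Rightarrow> nat) \<Rightarrow> real" where
  "blockmodel_divergence n p z =
     (\<Sum>(i, j)\<in>vertex_pairs n. bernoulli_KL (p i j) (block_average n z p (z i) (z j)))"

definition largest_community :: "nat \<Rightarrow> nat \<Rightarrow> (nat \<Rightarrow> nat) set \<Rightarrow> nat" where
  "largest_community n k Z = Max {community_size n z a | z a. z \<in> Z \<and> a \<in> {1..k}}"

text \<open>Boundedness in probability, \<open>X n = O\<^sub>P(r n)\<close>. Measurability is part of the definition because
  \<^const>\<open>measure\<close> is \<open>0\<close> on non-measurable sets, which would satisfy the tail bound vacuously.\<close>

definition big_O_P :: "'a measure \<Rightarrow> (nat \<Rightarrow> 'a \<Rightarrow> real) \<Rightarrow> (nat \<Rightarrow> real) \<Rightarrow> bool" where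
  "big_O_P M X r \<longleftrightarrow>
     (\<forall>n. X n \<in> borel_measurable M) \<and>
     (\<forall>\<epsilon>>0. \<exists>C>0. \<forall>\<^sub>F n in sequentially.
        measure M {\<omega> \<in> space M. \<bar>X n \<omega>\<bar> > C * \<bar>r n\<bar>} \<le> \<epsilon>)"

end

(*
  The Bernoulli divergence D(p || q) is at most (p - q)^2 / (q (1 - q)), so the quotient is
  controlled by the mean square deviation of f(xi_i, xi_j) from its block averages, and an average
  may be replaced by any constant, in particular by the value of f at a point attached to the
  block. Take for z the assignment obtained from the rank permutation of xi_1, ..., xi_n. Every
  community then occupies an interval of ranks of length at most h, so xi_i is within
  |xi_i - rank_i / n| + h / n of a point depending only on its community, and the Hoelder
  condition bounds the mean square deviation by a multiple of (h / n)^(2 alpha) plus the mean of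
  |xi_i - rank_i / n|^(2 alpha). Given xi_i, the number of sample points below it is binomial, so
  the sum of (xi_i - rank_i / n)^2 has bounded expectation, and Markov's inequality applies.
*)

theory Submission
  imports Defs
begin

section \<open>Blockmodel divergence and least squares\<close>

text \<open>Applying \<open>ln x \<le> x - 1\<close> to both logarithms leaves exactly the
  chi-square divergence of the two Bernoulli laws.\<close>

lemma bernoulli_KL_le:
  assumes "0 < p" "p < 1" "0 < q" "q < 1"
  shows "bernoulli_KL p q \<le> (p - q)\<^sup>2 / (q * (1 - q))"
proof -
  have "ln (p / q) \<le> p / q - 1" "ln ((1 - p) / (1 - q)) \<le> (1 - p) / (1 - q) - 1"
    using assms by (auto intro!: ln_le_minus_one divide_pos_pos)
  then have "bernoulli_KL p q \<le> p * (p / q - 1) + (1 - p) * ((1 - p) / (1 - q) - 1)"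
    unfolding bernoulli_KL_def using assms by (intro add_mono mult_left_mono) auto
  also have "\<dots> = (p - q)\<^sup>2 / (q * (1 - q))"
    using assms by (simp add: divide_simps) (simp add: power2_eq_square algebra_simps)
  finally show ?thesis .
qed

text \<open>The inequality \<open>ln x \<le> x - 1\<close> is now applied to the reciprocal ratios,
  where the linear terms add up to zero. Nonnegativity later removes the absolute value from the
  quotient.\<close>

lemma bernoulli_KL_nonneg:
  assumes "0 < p" "p < 1" "0 < q" "q < 1"
  shows "0 \<le> bernoulli_KL p q"
proof -
  have "ln (q / p) \<le> q / p - 1" "ln ((1 - q) / (1 - p)) \<le> (1 - q) / (1 - p) - 1"
    using assms by (auto intro!: ln_le_minus_one divide_pos_pos)
  then have "p * ln (q / p) + (1 - p) * ln ((1 - q) / (1 - p)) \<le>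
      p * (q / p - 1) + (1 - p) * ((1 - q) / (1 - p) - 1)"
    using assms by (intro add_mono mult_left_mono) auto
  also have "\<dots> = 0"
    using assms by (simp add: field_simps)
  finally show ?thesis
    using assms by (simp add: bernoulli_KL_def ln_div algebra_simps)
qed

text \<open>The mean is the best constant fit in least squares; this is what allows block averages
  to be replaced by values of the graphon.\<close>

lemma sum_square_deviation_mean_le:
  fixes g :: "'a \<Rightarrow> real"
  assumes "finite B"
  shows "(\<Sum>u\<in>B. (g u - sum g B / card B)\<^sup>2) \<le> (\<Sum>u\<in>B. (g u - c)\<^sup>2)"
proof (cases "B = {}")
  case False
  define m where "m = sum g B / card B"
  have m: "sum g B = card B * m"
    using False assms by (simp add: m_def)
  \<comment> \<open>The correction is affine in \<open>g u\<close>, so its sum depends on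
    \<open>g\<close> only through the mean and equals \<open>card B * (m - c)\<^sup>2\<close>, which
    is nonnegative.\<close>
  have "(\<Sum>u\<in>B. (g u - c)\<^sup>2) = (\<Sum>u\<in>B. (g u - m)\<^sup>2 + (2 * (m - c) * g u + (c\<^sup>2 - m\<^sup>2)))"
    by (intro sum.cong) (auto simp: power2_eq_square algebra_simps)
  also have "\<dots> = (\<Sum>u\<in>B. (g u - m)\<^sup>2) + card B * (m - c)\<^sup>2"
    unfolding sum.distrib sum_distrib_left[symmetric] m
    by (simp add: power2_eq_square algebra_simps)
  finally show ?thesis
    by (simp add: m_def)
qed simp

section \<open>Vertex pairs, blocks and block averages\<close>

lemma finite_vertex_pairs [simp]: "finite (vertex_pairs n)"
  by (rule finite_subset[of _ "{1..n} \<times> {1..n}"]) (auto simp: vertex_pairs_def)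

lemma finite_community [simp]: "finite (community n z a)"
  by (simp add: community_def)

lemma block_pairs_subset: "block_pairs n z a b \<subseteq> community n z a \<times> community n z b"
  by (auto simp: block_pairs_def)

lemma finite_block_pairs [simp]: "finite (block_pairs n z a b)"
  by (rule finite_subset[OF block_pairs_subset]) simp

text \<open>Off-diagonal blocks are full rectangles, so this also covers \<open>i < j\<close> with
  \<open>z i > z j\<close>. In particular every block that the divergence refers to is
  nonempty.\<close>

lemma vertex_pair_in_block_pairs:
  "(i, j) \<in> vertex_pairs n \<Longrightarrow> (i, j) \<in> block_pairs n z (z i) (z j)"
  by (auto simp: vertex_pairs_def block_pairs_def community_def)

lemma in_block_pairsD:
  assumes "(i, j) \<in> block_pairs n z a b"
  shows "i \<in> {1..n}" "j \<in> {1..n}" "z i = a" "z j = b" "i \<noteq> j"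
  using assms by (auto simp: block_pairs_def community_def split: if_splits)

lemma card_vertex_pairs: "2 * card (vertex_pairs n) = n * (n - 1)"
proof (induction n)
  case 0
  have "vertex_pairs 0 = {}" by (auto simp: vertex_pairs_def)
  then show ?case by simp
next
  case (Suc n)
  have eq: "vertex_pairs (Suc n) = vertex_pairs n \<union> (\<lambda>i. (i, Suc n)) ` {1..n}"
    by (auto simp: vertex_pairs_def)
  have "card (vertex_pairs (Suc n)) = card (vertex_pairs n) + card ((\<lambda>i. (i, Suc n)) ` {1..n})"
    unfolding eq
    by (intro card_Un_disjoint finite_vertex_pairs finite_imageI finite_atLeastAtMost)
      (auto simp: vertex_pairs_def)
  also have "card ((\<lambda>i. (i, Suc n)) ` {1..n}) = n"
    by (subst card_image) (auto simp: inj_on_def)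
  finally have "2 * card (vertex_pairs (Suc n)) = n * (n - 1) + 2 * n"
    using Suc by simp
  then show ?case by (cases n) auto
qed

text \<open>Nonemptiness matters: the average over an empty block is \<open>0 / 0 = 0\<close>, which
  could fall below \<open>l\<close>.\<close>

lemma block_average_bounds:
  assumes "\<And>i j. i \<in> {1..n} \<Longrightarrow> j \<in> {1..n} \<Longrightarrow> i \<noteq> j \<Longrightarrow> l \<le> p i j \<and> p i j \<le> u"
    and "block_pairs n z a b \<noteq> {}"
  shows "block_average n z p a b \<in> {l..u}"
proof -
  have "card (block_pairs n z a b) > 0"
    using assms(2) by (simp add: card_gt_0_iff)
  moreover have "real (card (block_pairs n z a b)) * l \<le> (\<Sum>(i, j)\<in>block_pairs n z a b. p i j)"
    using assms(1) in_block_pairsD by (intro sum_bounded_below) (auto simp del: atLeastAtMost_iff)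
  moreover have "(\<Sum>(i, j)\<in>block_pairs n z a b. p i j) \<le> real (card (block_pairs n z a b)) * u"
    using assms(1) in_block_pairsD by (intro sum_bounded_above) (auto simp del: atLeastAtMost_iff)
  ultimately show ?thesis
    by (simp add: block_average_def field_simps)
qed

text \<open>The average is optimal only for the sum over its whole block, whereas the pairs
  \<open>i < j\<close> may fill just a part of an off-diagonal block. The sum is therefore enlarged
  to all blocks, compared there with \<open>q\<close> block by block, and enlarged again to all
  ordered pairs.\<close>

lemma block_average_square_deviation_le:
  assumes "z \<in> {1..n} \<rightarrow> {1..k}"
  shows "(\<Sum>(i, j)\<in>vertex_pairs n. (p i j - block_average n z p (z i) (z j))\<^sup>2)
    \<le> (\<Sum>i\<in>{1..n}. \<Sum>j\<in>{1..n}. (p i j - q (z i) (z j))\<^sup>2)"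
proof -
  \<comment> \<open>The blocks are pairwise disjoint, since a pair \<open>(i, j)\<close> determines
    its block as \<open>(z i, z j)\<close>.\<close>
  define U where "U = (\<Union>(a, b)\<in>{1..k} \<times> {1..k}. block_pairs n z a b)"
  have sum_U: "(\<Sum>(i, j)\<in>U. (p i j - s (z i) (z j))\<^sup>2)
      = (\<Sum>(a, b)\<in>{1..k} \<times> {1..k}. \<Sum>(i, j)\<in>block_pairs n z a b. (p i j - s a b)\<^sup>2)" for s
  proof -
    have "(\<Sum>(i, j)\<in>U. (p i j - s (z i) (z j))\<^sup>2)
      = (\<Sum>(a, b)\<in>{1..k} \<times> {1..k}. \<Sum>(i, j)\<in>block_pairs n z a b. (p i j - s (z i) (z j))\<^sup>2)"
      unfolding U_def
      by (subst sum.UNION_disjoint, auto simp: split_def)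
        (metis in_block_pairsD(3), metis in_block_pairsD(4))
    also have "\<dots> = (\<Sum>(a, b)\<in>{1..k} \<times> {1..k}. \<Sum>(i, j)\<in>block_pairs n z a b. (p i j - s a b)\<^sup>2)"
      by (intro sum.cong refl) (auto intro!: sum.cong dest: in_block_pairsD(3,4))
    finally show ?thesis .
  qed
  have "vertex_pairs n \<subseteq> U"
  proof
    fix v assume v: "v \<in> vertex_pairs n"
    obtain i j where ij: "v = (i, j)" by fastforce
    have "i \<in> {1..n}" "j \<in> {1..n}" using v ij by (auto simp: vertex_pairs_def)
    then show "v \<in> U"
      using vertex_pair_in_block_pairs[of i j n z] v assms unfolding U_def ij
      by (intro UN_I[of "(z i, z j)"]) auto
  qed
  moreover have "finite U" by (auto simp: U_def)
  ultimately have "(\<Sum>(i, j)\<in>vertex_pairs n. (p i j - block_average n z p (z i) (z j))\<^sup>2)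
      \<le> (\<Sum>(i, j)\<in>U. (p i j - block_average n z p (z i) (z j))\<^sup>2)"
    by (intro sum_mono2) auto
  also have "\<dots> \<le> (\<Sum>(a, b)\<in>{1..k} \<times> {1..k}. \<Sum>(i, j)\<in>block_pairs n z a b. (p i j - q a b)\<^sup>2)"
    unfolding sum_U
  proof (intro sum_mono, clarify)
    fix a b
    show "(\<Sum>(i, j)\<in>block_pairs n z a b. (p i j - block_average n z p a b)\<^sup>2)
        \<le> (\<Sum>(i, j)\<in>block_pairs n z a b. (p i j - q a b)\<^sup>2)"
      using sum_square_deviation_mean_le[of "block_pairs n z a b" "\<lambda>(i, j). p i j" "q a b"]
      by (simp add: block_average_def split_def)
  qed
  also have "\<dots> = (\<Sum>(i, j)\<in>U. (p i j - q (z i) (z j))\<^sup>2)"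
    by (rule sum_U[symmetric])
  also have "\<dots> \<le> (\<Sum>(i, j)\<in>{1..n} \<times> {1..n}. (p i j - q (z i) (z j))\<^sup>2)"
    by (intro sum_mono2) (auto simp: U_def dest: in_block_pairsD)
  finally show ?thesis
    by (simp add: sum.cartesian_product)
qed

text \<open>The averages lie in the same interval from \<open>l\<close> to
  \<open>1 - \<delta>\<close> as the probabilities, so the chi-square denominators are at least
  \<open>l * \<delta>\<close>. The block constants \<open>q\<close> remain free to be
  chosen.\<close>

lemma blockmodel_divergence_le:
  assumes p: "\<And>i j. i \<in> {1..n} \<Longrightarrow> j \<in> {1..n} \<Longrightarrow> i \<noteq> j \<Longrightarrow> l \<le> p i j \<and> p i j \<le> 1 - \<delta>"
    and "0 < l" "0 < \<delta>" and z: "z \<in> {1..n} \<rightarrow> {1..k}"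
  shows "blockmodel_divergence n p z
    \<le> (\<Sum>i\<in>{1..n}. \<Sum>j\<in>{1..n}. (p i j - q (z i) (z j))\<^sup>2) / (l * \<delta>)"
proof -
  have "bernoulli_KL (p i j) (block_average n z p (z i) (z j))
      \<le> (p i j - block_average n z p (z i) (z j))\<^sup>2 / (l * \<delta>)"
    if ij: "(i, j) \<in> vertex_pairs n" for i j
  proof -
    let ?q = "block_average n z p (z i) (z j)"
    have q: "l \<le> ?q" "?q \<le> 1 - \<delta>"
      using block_average_bounds[of n l p "1 - \<delta>" z "z i" "z j"] p
        vertex_pair_in_block_pairs[OF ij] by auto
    have "bernoulli_KL (p i j) ?q \<le> (p i j - ?q)\<^sup>2 / (?q * (1 - ?q))"
      using p[of i j] ij q \<open>0 < l\<close> \<open>0 < \<delta>\<close> 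
      by (intro bernoulli_KL_le) (auto simp: vertex_pairs_def)
    also have "\<dots> \<le> (p i j - ?q)\<^sup>2 / (l * \<delta>)"
      using q \<open>0 < l\<close> \<open>0 < \<delta>\<close> by (intro divide_left_mono mult_mono mult_pos_pos) auto
    finally show ?thesis .
  qed
  then have "blockmodel_divergence n p z
      \<le> (\<Sum>(i, j)\<in>vertex_pairs n. (p i j - block_average n z p (z i) (z j))\<^sup>2 / (l * \<delta>))"
    unfolding blockmodel_divergence_def by (intro sum_mono) auto
  also have "\<dots> = (\<Sum>(i, j)\<in>vertex_pairs n. (p i j - block_average n z p (z i) (z j))\<^sup>2) / (l * \<delta>)"
    by (simp add: sum_divide_distrib split_def)
  also have "\<dots> \<le> (\<Sum>i\<in>{1..n}. \<Sum>j\<in>{1..n}. (p i j - q (z i) (z j))\<^sup>2) / (l * \<delta>)"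
    using block_average_square_deviation_le[OF z] \<open>0 < l\<close> \<open>0 < \<delta>\<close>
    by (intro divide_right_mono) auto
  finally show ?thesis .
qed

lemma blockmodel_divergence_nonneg:
  assumes p: "\<And>i j. i \<in> {1..n} \<Longrightarrow> j \<in> {1..n} \<Longrightarrow> i \<noteq> j \<Longrightarrow> l \<le> p i j \<and> p i j \<le> u"
    and "0 < l" "u < 1"
  shows "0 \<le> blockmodel_divergence n p z"
  unfolding blockmodel_divergence_def
proof (intro sum_nonneg, clarify)
  fix i j assume ij: "(i, j) \<in> vertex_pairs n"
  have "block_average n z p (z i) (z j) \<in> {l..u}"
    using block_average_bounds[of n l p u z "z i" "z j"] p
      vertex_pair_in_block_pairs[OF ij] by auto
  then show "0 \<le> bernoulli_KL (p i j) (block_average n z p (z i) (z j))"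
    using p[of i j] ij assms(2,3) by (intro bernoulli_KL_nonneg) (auto simp: vertex_pairs_def)
qed

section \<open>Assignments generated by community sizes and a permutation\<close>

lemma finite_assignments: "finite (assignments n k)"
  by (rule finite_subset[of _ "{1..n} \<rightarrow>\<^sub>E {1..k}"])
    (auto simp: assignments_def intro!: finite_PiE)

lemma sum_community_size:
  assumes "z \<in> {1..n} \<rightarrow> {1..k}"
  shows "(\<Sum>a = 1..k. community_size n z a) = n"
proof -
  have "(\<Sum>a\<in>{1..k}. card (community n z a)) = card (\<Union>a\<in>{1..k}. community n z a)"
    by (subst card_UN_disjoint) (auto simp: community_def)
  also have "(\<Union>a\<in>{1..k}. community n z a) = {1..n}"
    using assms by (auto simp: community_def)
  finally show ?thesis by (simp add: community_size_def)
qed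

text \<open>The cumulative size jumps only at integers, so its generalised inverse at
  \<open>\<pi> i / n\<close> is the first community whose cumulative size reaches
  \<open>\<pi> i\<close>.\<close>

lemma permuted_assignment_eq:
  assumes h: "(\<Sum>a = 1..k. h a) = n" and i: "i \<in> {1..n}" and \<pi>: "\<pi> i \<in> {1..n}"
  obtains a where "a \<in> {1..k}" "permuted_assignment n k h \<pi> i = a"
    "sum h {1..a - 1} < \<pi> i" "\<pi> i \<le> sum h {1..a}"
proof -
  define a where "a = (LEAST a. \<pi> i \<le> sum h {1..a})"
  have ex: "\<pi> i \<le> sum h {1..k}" using h \<pi> by simp
  have ge: "\<pi> i \<le> sum h {1..a}"
    unfolding a_def by (rule LeastI[of _ k]) (rule ex)
  have least: "a \<le> m" if "\<pi> i \<le> sum h {1..m}" for m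
    unfolding a_def by (rule Least_le) (rule that)
  \<comment> \<open>The cumulative size up to \<open>0\<close> is an empty sum, while
    \<open>\<pi> i\<close> is at least \<open>1\<close>.\<close>
  have "a \<noteq> 0" using ge \<pi> by (intro notI) auto
  then have a: "a \<in> {1..k}" using least[OF ex] by auto
  have lt: "sum h {1..a - 1} < \<pi> i"
    using least[of "a - 1"] \<open>a \<noteq> 0\<close> by (meson diff_less less_one linorder_not_less not_gr_zero)
  have n: "0 < n" using i by auto
  \<comment> \<open>The infimum is thus attained at the integer \<open>a\<close>, and the floor in
    \<open>permuted_assignment\<close> loses nothing.\<close>
  have "{u \<in> {0..real k}. real (\<pi> i) / real n \<le> cumulative_size n h u} = {real a..real k}"
  proof safe
    fix u assume u: "u \<in> {0..real k}" "real (\<pi> i) / real n \<le> cumulative_size n h u"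
    then have "real (\<pi> i) \<le> real (sum h {1..nat \<lfloor>u\<rfloor>})"
      using n by (simp add: cumulative_size_def field_simps)
    then have "a \<le> nat \<lfloor>u\<rfloor>" by (intro least) (simp only: of_nat_le_iff)
    then show "u \<in> {real a..real k}" using u by (auto simp: le_nat_floor nat_le_iff) linarith
  next
    fix u assume u: "u \<in> {real a..real k}"
    then show "u \<in> {0..real k}" by auto
    have "a \<le> nat \<lfloor>u\<rfloor>" using u by (simp add: le_nat_floor)
    then have "sum h {1..a} \<le> sum h {1..nat \<lfloor>u\<rfloor>}" by (intro sum_mono2) auto
    with ge have "\<pi> i \<le> sum h {1..nat \<lfloor>u\<rfloor>}" by simp
    then have "real (\<pi> i) \<le> real (sum h {1..nat \<lfloor>u\<rfloor>})" by (rule of_nat_mono)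
    then show "real (\<pi> i) / real n \<le> cumulative_size n h u"
      using n by (simp add: cumulative_size_def field_simps)
  qed
  then have "permuted_assignment n k h \<pi> i = a"
    using i a by (simp add: permuted_assignment_def cumulative_size_inv_def)
  then show ?thesis using that a lt ge by blast
qed

section \<open>Power and distance inequalities, and centres of communities\<close>

text \<open>The base is at most four times the largest of the three numbers, and
  \<open>4 powr (2 * \<alpha>) \<le> 16\<close>. The term \<open>w\<close> enters twice because each
  of the two coordinates contributes one community width.\<close>

lemma powr_sum_le:
  fixes x y w :: real
  assumes "0 \<le> x" "0 \<le> y" "0 \<le> w" "0 < \<alpha>" "\<alpha> \<le> 1"
  shows "(x + y + 2 * w) powr (2 * \<alpha>)
    \<le> 16 * (x powr (2 * \<alpha>) + y powr (2 * \<alpha>) + w powr (2 * \<alpha>))"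
proof -
  define m where "m = max x (max y w)"
  have m: "m \<ge> 0" "x + y + 2 * w \<le> 4 * m" using assms by (auto simp: m_def)
  have "(x + y + 2 * w) powr (2 * \<alpha>) \<le> (4 * m) powr (2 * \<alpha>)"
    using m assms by (intro powr_mono2) auto
  also have "\<dots> = 4 powr (2 * \<alpha>) * m powr (2 * \<alpha>)"
    using m by (simp add: powr_mult)
  also have "\<dots> \<le> 4 powr 2 * m powr (2 * \<alpha>)"
    using assms by (intro mult_right_mono powr_mono) auto
  also have "m powr (2 * \<alpha>) \<le> x powr (2 * \<alpha>) + y powr (2 * \<alpha>) + w powr (2 * \<alpha>)"
    by (auto simp: m_def max_def)
  finally show ?thesis by (simp add: powr_numeral)
qed

text \<open>With \<open>s = n\<close> this replaces Jensen's inequality: it passes from the mean square rank error, which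
  is \<open>O(1 / n)\<close>, to the power \<open>2 \<alpha>\<close>.\<close>

lemma abs_powr_le_scaled:
  fixes x s :: real
  assumes "0 < s" "0 < \<alpha>" "\<alpha> \<le> 1"
  shows "\<bar>x\<bar> powr (2 * \<alpha>) \<le> s powr (- \<alpha>) * (1 + s * x\<^sup>2)"
proof -
  define t where "t = s * x\<^sup>2"
  have t: "t \<ge> 0" using assms by (simp add: t_def)
  have "\<bar>x\<bar> powr (2 * \<alpha>) = (x\<^sup>2) powr \<alpha>"
    by (subst powr_powr[symmetric]) (simp add: powr_numeral)
  also have "\<dots> = s powr (- \<alpha>) * t powr \<alpha>"
    using assms by (simp add: t_def powr_mult powr_minus field_simps)
  also have "t powr \<alpha> \<le> 1 + t"
  proof (cases "t \<le> 1")
    case True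
    then show ?thesis using t assms powr_mono2[of \<alpha> t 1] by simp
  next
    case False
    then show ?thesis using assms powr_mono[of \<alpha> 1 t] by simp
  qed
  finally show ?thesis by (simp add: t_def mult_left_mono)
qed

lemma dist_Pair_le: "dist (a, b) (c, d) \<le> dist a c + dist b d"
  unfolding dist_Pair_Pair by (rule sqrt_sum_squares_le_sum) auto

lemma community_size_le_largest:
  assumes "z \<in> Z" "Z \<subseteq> assignments n k" "a \<in> {1..k}"
  shows "community_size n z a \<le> largest_community n k Z"
proof -
  have "{community_size n z a | z a. z \<in> Z \<and> a \<in> {1..k}}
      = (\<lambda>(z, a). community_size n z a) ` (Z \<times> {1..k})"
    by (auto simp: image_iff simp del: atLeastAtMost_iff)
  moreover have "finite (Z \<times> {1..k})"
    using finite_subset[OF assms(2) finite_assignments] by simp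
  ultimately have "finite {community_size n z a | z a. z \<in> Z \<and> a \<in> {1..k}}"
    by simp
  then show ?thesis
    unfolding largest_community_def using assms by (intro Max_ge) auto
qed

text \<open>The centre \<open>y a\<close> is the smallest normalised rank in community \<open>a\<close>; it is less than \<open>1\<close> because
  communities have size at least \<open>2\<close>.\<close>

lemma permuted_assignment_centres:
  assumes z: "z \<in> assignments n k" and \<pi>: "\<pi> permutes {1..n}"
    and m: "\<And>a. a \<in> {1..k} \<Longrightarrow> community_size n z a \<le> m"
  obtains y :: "nat \<Rightarrow> real" where
    "permuted_assignment n k (community_size n z) \<pi> \<in> {1..n} \<rightarrow> {1..k}"
    "\<And>a. a \<in> {1..k} \<Longrightarrow> y a \<in> {0<..<1}"
    "\<And>i. i \<in> {1..n} \<Longrightarrow>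
      \<bar>real (\<pi> i) / real n - y (permuted_assignment n k (community_size n z) \<pi> i)\<bar>
        \<le> real m / real n"
proof
  let ?h = "community_size n z"
  let ?z = "permuted_assignment n k ?h \<pi>"
  define y where "y a = real (sum ?h {1..a - 1} + 1) / real n" for a
  have sum: "sum ?h {1..k} = n"
    using z by (intro sum_community_size) (auto simp: assignments_def)
  have split: "sum ?h {1..a} = sum ?h {1..a - 1} + ?h a" if "a \<in> {1..k}" for a
    using that by (cases a) auto
  have ex: "\<exists>a \<in> {1..k}. ?z i = a \<and> sum ?h {1..a - 1} < \<pi> i \<and> \<pi> i \<le> sum ?h {1..a}"
    if i: "i \<in> {1..n}" for i
    using permuted_assignment_eq[OF sum i, of \<pi>] i permutes_in_image[OF \<pi>, of i] by metis
  show "?z \<in> {1..n} \<rightarrow> {1..k}"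
    using ex by blast
  show "y a \<in> {0<..<1}" if a: "a \<in> {1..k}" for a
  proof -
    have "2 \<le> ?h a" using z a by (auto simp: assignments_def)
    moreover have "sum ?h {1..a} \<le> sum ?h {1..k}" using a by (intro sum_mono2) auto
    ultimately have "sum ?h {1..a - 1} + 1 < n" using split[OF a] sum by linarith
    then have "real (sum ?h {1..a - 1} + 1) < real n" by (rule of_nat_less_iff[THEN iffD2])
    then show ?thesis
      by (simp only: y_def greaterThanLessThan_iff) (simp del: of_nat_sum)
  qed
  show "\<bar>real (\<pi> i) / real n - y (?z i)\<bar> \<le> real m / real n" if i: "i \<in> {1..n}" for i
  proof -
    obtain a where a: "a \<in> {1..k}" "?z i = a" "sum ?h {1..a - 1} < \<pi> i" "\<pi> i \<le> sum ?h {1..a}"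
      using ex[OF i] by blast
    have "\<bar>real (\<pi> i) - real (sum ?h {1..a - 1} + 1)\<bar> \<le> real m"
      using a split[OF a(1)] m[OF a(1)] by linarith
    then have "\<bar>real (\<pi> i) - real (sum ?h {1..a - 1} + 1)\<bar> / real n \<le> real m / real n"
      by (intro divide_right_mono) auto
    then show ?thesis
      unfolding a(2) y_def diff_divide_distrib[symmetric] by simp
  qed
qed

section \<open>Ranks of a uniform sample\<close>

text \<open>Fubini's theorem for the joint law, which independence turns into a product. It serves
  as conditioning on \<open>X\<close>: the inner integral freezes \<open>X \<omega>\<close>.\<close>

lemma (in prob_space) expectation_indep_var:
  fixes h :: "'b \<times> 'b \<Rightarrow> real"
  assumes ind: "indep_var S X T Y" and h [measurable]: "h \<in> borel_measurable (S \<Otimes>\<^sub>M T)"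
    and int: "integrable M (\<lambda>\<omega>. h (X \<omega>, Y \<omega>))"
  shows "expectation (\<lambda>\<omega>. h (X \<omega>, Y \<omega>)) = (\<integral>\<omega>. (\<integral>\<omega>'. h (X \<omega>, Y \<omega>') \<partial>M) \<partial>M)"
proof -
  have [measurable]: "random_variable S X" "random_variable T Y"
    and eq: "distr M (S \<Otimes>\<^sub>M T) (\<lambda>\<omega>. (X \<omega>, Y \<omega>)) = distr M S X \<Otimes>\<^sub>M distr M T Y"
    using ind by (auto simp: indep_var_distribution_eq)
  interpret X: prob_space "distr M S X" by (rule prob_space_distr) simp
  interpret Y: prob_space "distr M T Y" by (rule prob_space_distr) simp
  interpret XY: pair_prob_space "distr M S X" "distr M T Y" ..
  have "integrable (distr M S X \<Otimes>\<^sub>M distr M T Y) h"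
    unfolding eq[symmetric] by (subst integrable_distr_eq) (auto intro: int)
  from XY.integral_fst'[OF this]
  have "(\<integral>x. (\<integral>y. h (x, y) \<partial>distr M T Y) \<partial>distr M S X) = expectation (\<lambda>\<omega>. h (X \<omega>, Y \<omega>))"
    unfolding eq[symmetric] by (simp add: integral_distr)
  moreover have "(\<integral>x. (\<integral>y. h (x, y) \<partial>distr M T Y) \<partial>distr M S X)
      = (\<integral>\<omega>. (\<integral>y. h (X \<omega>, y) \<partial>distr M T Y) \<partial>M)"
    by (rule integral_distr) simp_all
  moreover have "(\<integral>y. h (X \<omega>, y) \<partial>distr M T Y) = (\<integral>\<omega>'. h (X \<omega>, Y \<omega>') \<partial>M)"
    if "\<omega> \<in> space M" for \<omega>
    using measurable_space[OF \<open>random_variable S X\<close> that] by (intro integral_distr) simp_all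
  ultimately show ?thesis
    by (simp cong: Bochner_Integration.integral_cong)
qed

text \<open>Ties are broken by the index, so that the ranks form a permutation for every sample and
  not just almost surely. Outside \<open>{1..n}\<close> the value is \<open>i\<close>, as
  \<open>permutes\<close> demands.\<close>

definition sample_rank :: "nat \<Rightarrow> (nat \<Rightarrow> 'a::linorder) \<Rightarrow> nat \<Rightarrow> nat" where
  "sample_rank n x i =
     (if i \<in> {1..n} then card {j \<in> {1..n}. x j < x i \<or> x j = x i \<and> j \<le> i} else i)"

lemma sample_rank_permutes: "sample_rank n x permutes {1..n}"
proof (rule inj_imp_permutes)
  let ?S = "\<lambda>i. {j \<in> {1..n}. x j < x i \<or> x j = x i \<and> j \<le> i}"
  have less: "sample_rank n x i < sample_rank n x j"
    if "i \<in> {1..n}" "j \<in> {1..n}" "x i < x j \<or> x i = x j \<and> i < j" for i j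
  proof -
    \<comment> \<open>Predecessor sets of the lexicographic order on \<open>(x i, i)\<close> are
      nested, and strictly so because \<open>j\<close> belongs only to \<open>?S j\<close>.\<close>
    have "?S i \<subset> ?S j" using that by fastforce
    then have "card (?S i) < card (?S j)" by (intro psubset_card_mono) simp_all
    then show ?thesis
      using that(1,2) by (simp add: sample_rank_def)
  qed
  show "inj_on (sample_rank n x) {1..n}"
  proof (rule inj_onI, rule ccontr)
    fix i j assume ij: "i \<in> {1..n}" "j \<in> {1..n}" "sample_rank n x i = sample_rank n x j" "i \<noteq> j"
    then have "x i < x j \<or> x i = x j \<and> i < j \<or> x j < x i \<or> x j = x i \<and> j < i" by (meson linorder_less_linear)
    then show False using less[OF ij(1,2)] less[OF ij(2,1)] ij(3) by linarith
  qed
  fix i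
  show "i \<in> {1..n} \<Longrightarrow> sample_rank n x i \<in> {1..n}"
  proof -
    assume i: "i \<in> {1..n}"
    have "card {i} \<le> card (?S i)" using i by (intro card_mono) auto
    moreover have "card (?S i) \<le> card {1..n}" by (intro card_mono) auto
    ultimately show "sample_rank n x i \<in> {1..n}" using i by (simp add: sample_rank_def)
  qed
  show "i \<notin> {1..n} \<Longrightarrow> sample_rank n x i = i" by (auto simp: sample_rank_def)
qed simp

text \<open>Splitting off the index \<open>i\<close>, which always counts itself, leaves
  \<open>n - 1\<close> indicators that can be centred one by one.\<close>

lemma real_sample_rank:
  assumes "i \<in> {1..n}"
  shows "real (sample_rank n x i)
    = 1 + (\<Sum>j\<in>{1..n} - {i}. if x j < x i \<or> x j = x i \<and> j < i then 1 else 0)"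
proof -
  let ?T = "{j \<in> {1..n} - {i}. x j < x i \<or> x j = x i \<and> j < i}"
  have "{j \<in> {1..n}. x j < x i \<or> x j = x i \<and> j \<le> i} = insert i ?T"
    using assms by auto
  then have "sample_rank n x i = Suc (card ?T)"
    using assms by (simp add: sample_rank_def)
  moreover have "real (card ?T) = (\<Sum>j\<in>{1..n} - {i}. if x j < x i \<or> x j = x i \<and> j < i then 1 else 0)"
    by (subst sum.inter_filter[symmetric]) auto
  ultimately show ?thesis by simp
qed

section \<open>Mean square error of the normalised ranks\<close>

context scaled_exchangeable_graph
begin

text \<open>For \<open>j \<noteq> i\<close> this is the indicator from the rank formula, centred at
  its conditional mean given \<open>\<xi> i\<close>.\<close>

definition rank_deviation :: "nat \<Rightarrow> nat \<Rightarrow> 'a \<Rightarrow> real" where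
  "rank_deviation i j \<omega> =
     (if \<xi> j \<omega> < \<xi> i \<omega> \<or> \<xi> j \<omega> = \<xi> i \<omega> \<and> j < i then 1 else 0) - \<xi> i \<omega>"

lemma latent_measurable [measurable]: "1 \<le> i \<Longrightarrow> \<xi> i \<in> borel_measurable M"
  using latent_indep by (auto simp: indep_vars_def)

lemma rank_deviation_measurable [measurable]:
  "1 \<le> i \<Longrightarrow> 1 \<le> j \<Longrightarrow> rank_deviation i j \<in> borel_measurable M"
  unfolding rank_deviation_def by measurable

lemma abs_rank_deviation_le: "1 \<le> i \<Longrightarrow> \<omega> \<in> space M \<Longrightarrow> \<bar>rank_deviation i j \<omega>\<bar> \<le> 1"
  using latent_range[of i \<omega>] by (auto simp: rank_deviation_def)

lemma abs_rank_deviation_mult_le: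
  assumes "1 \<le> i" "\<omega> \<in> space M"
  shows "\<bar>rank_deviation i j \<omega> * rank_deviation i l \<omega>\<bar> \<le> 1"
  unfolding abs_mult
  using mult_mono[OF abs_rank_deviation_le[OF assms, of j] abs_rank_deviation_le[OF assms, of l]]
  by simp

lemma integrable_rank_deviation_mult:
  "1 \<le> i \<Longrightarrow> 1 \<le> j \<Longrightarrow> 1 \<le> l \<Longrightarrow>
    integrable M (\<lambda>\<omega>. rank_deviation i j \<omega> * rank_deviation i l \<omega>)"
  by (rule integrable_const_bound[where B = 1]) (auto intro!: AE_I2 abs_rank_deviation_mult_le)

text \<open>A uniform variable lies below \<open>x\<close> with probability \<open>x\<close>. The
  proposition \<open>P\<close> carries the tie-breaking rule, which decides only about the null
  event that the variable equals \<open>x\<close>.\<close>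

lemma expectation_latent_below:
  assumes "1 \<le> l" "x \<in> {0<..<1}"
  shows "(\<integral>\<omega>. (if \<xi> l \<omega> < x \<or> \<xi> l \<omega> = x \<and> P then 1 else 0) - x \<partial>M) = 0"
proof -
  let ?A = "if P then {..x} else {..<x}"
  define E where "E = {\<omega> \<in> space M. \<xi> l \<omega> \<in> ?A}"
  have "prob {\<omega> \<in> space M. \<xi> l \<omega> \<in> ?A} = measure (distr M borel (\<xi> l)) ?A"
    using assms by (subst measure_distr) (auto intro!: arg_cong[where f = prob])
  also have "\<dots> = measure lborel ({0<..<1} \<inter> ?A) / measure lborel {0<..<1::real}"
    unfolding latent_uniform[OF assms(1)] by (subst measure_uniform_measure) auto
  also have "{0<..<1} \<inter> ?A = (if P then {0<..x} else {0<..<x})"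
    using assms by auto
  finally have "prob E = x"
    using assms by (simp add: E_def split: if_splits)
  moreover have "(\<integral>\<omega>. (if \<xi> l \<omega> < x \<or> \<xi> l \<omega> = x \<and> P then 1 else 0) - x \<partial>M)
      = (\<integral>\<omega>. indicator E \<omega> - x \<partial>M)"
    by (intro Bochner_Integration.integral_cong) (auto simp: E_def split: if_splits)
  moreover have E: "E \<in> events"
    using measurable_sets[OF latent_measurable[OF assms(1)], of ?A]
    by (simp add: E_def vimage_def Int_def conj_commute)
  moreover have "expectation (\<lambda>\<omega>. indicator E \<omega> - x) = prob E - x"
    using E by (subst Bochner_Integration.integral_diff)
      (auto simp: prob_space less_top[symmetric])
  ultimately show ?thesis by simp
qed

text \<open>Given \<open>\<xi> i\<close> and \<open>\<xi> j\<close>, the first factor is constant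
  and the second has mean zero, because \<open>\<xi> l\<close> is independent of both.\<close>

lemma expectation_rank_deviation_mult_eq_0:
  assumes "1 \<le> i" "1 \<le> j" "1 \<le> l" "l \<noteq> i" "l \<noteq> j"
  shows "expectation (\<lambda>\<omega>. rank_deviation i j \<omega> * rank_deviation i l \<omega>) = 0"
proof -
  \<comment> \<open>The variables are grouped into two disjoint index sets, and \<open>h\<close>
    expresses the product of deviations through the two groups.\<close>
  define X where "X = (\<lambda>\<omega>. restrict (\<lambda>m. \<xi> m \<omega>) {i, j})"
  define Y where "Y = (\<lambda>\<omega>. restrict (\<lambda>m. \<xi> m \<omega>) {l})"
  define h where "h = (\<lambda>(v, w). ((if v j < v i \<or> v j = v i \<and> j < i then 1 else 0) - v i) *
     ((if w l < v i \<or> w l = v i \<and> l < i then 1 else 0) - (v i :: real)))"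
  have ind: "indep_var (PiM {i, j} (\<lambda>_. borel)) X (PiM {l} (\<lambda>_. borel)) Y"
    unfolding X_def Y_def using assms by (intro indep_var_restrict[OF latent_indep]) auto
  have [measurable]: "h \<in> borel_measurable (PiM {i, j} (\<lambda>_. borel) \<Otimes>\<^sub>M PiM {l} (\<lambda>_. borel))"
  proof -
    have [measurable]: "(\<lambda>v. fst v m) \<in> borel_measurable (PiM {i, j} (\<lambda>_. borel) \<Otimes>\<^sub>M PiM {l} (\<lambda>_. borel))"
      if "m \<in> {i, j}" for m
      by (rule measurable_compose[OF measurable_fst measurable_component_singleton[OF that]])
    have [measurable]: "(\<lambda>v. snd v l) \<in> borel_measurable (PiM {i, j} (\<lambda>_. borel) \<Otimes>\<^sub>M PiM {l} (\<lambda>_. borel))"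
      by (rule measurable_compose[OF measurable_snd measurable_component_singleton]) simp
    show ?thesis
      unfolding h_def split_def by measurable
  qed
  have h_eq: "(\<lambda>\<omega>. h (X \<omega>, Y \<omega>)) = (\<lambda>\<omega>. rank_deviation i j \<omega> * rank_deviation i l \<omega>)"
    by (simp add: h_def X_def Y_def rank_deviation_def)
  have "expectation (\<lambda>\<omega>. h (X \<omega>, Y \<omega>)) = (\<integral>\<omega>. (\<integral>\<omega>'. h (X \<omega>, Y \<omega>') \<partial>M) \<partial>M)"
    using assms by (intro expectation_indep_var[OF ind]) (simp_all add: h_eq integrable_rank_deviation_mult)
  also have "\<dots> = (\<integral>\<omega>. 0 \<partial>M)"
  proof (intro Bochner_Integration.integral_cong refl)
    fix \<omega> assume "\<omega> \<in> space M"
    then show "(\<integral>\<omega>'. h (X \<omega>, Y \<omega>') \<partial>M) = 0"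
      using latent_range[of i \<omega>] expectation_latent_below[of l "\<xi> i \<omega>" "l < i"] assms
      by (simp add: h_def X_def Y_def)
  qed
  finally show ?thesis by (simp add: h_eq)
qed

definition rank_error :: "nat \<Rightarrow> 'a \<Rightarrow> nat \<Rightarrow> real" where
  "rank_error n \<omega> i = \<xi> i \<omega> - real (sample_rank n (\<lambda>j. \<xi> j \<omega>) i) / real n"

text \<open>Undoing the centring of the \<open>n - 1\<close> indicators contributes
  \<open>(n - 1) * \<xi> i \<omega>\<close> to the rank; comparison with
  \<open>n * \<xi> i \<omega>\<close> leaves the bounded bias
  \<open>1 - \<xi> i \<omega>\<close>.\<close>

lemma rank_error_eq:
  assumes "i \<in> {1..n}"
  shows "rank_error n \<omega> i
    = - (1 - \<xi> i \<omega> + (\<Sum>j\<in>{1..n} - {i}. rank_deviation i j \<omega>)) / real n"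
  using assms by (simp add: rank_error_def real_sample_rank rank_deviation_def sum_subtractf field_simps)

lemma rank_error_measurable [measurable]:
  assumes "i \<in> {1..n}"
  shows "(\<lambda>\<omega>. rank_error n \<omega> i) \<in> borel_measurable M"
proof -
  have "1 \<le> i" using assms by simp
  have [measurable]: "(\<lambda>\<omega>. \<Sum>j\<in>{1..n} - {i}. rank_deviation i j \<omega>) \<in> borel_measurable M"
    using assms by (intro borel_measurable_sum rank_deviation_measurable) auto
  show ?thesis
    unfolding rank_error_eq[OF assms] using \<open>1 \<le> i\<close> by measurable
qed

text \<open>For fixed \<open>i\<close> the deviations are uncorrelated and bounded by
  \<open>1\<close>, so their sum has second moment at most \<open>n\<close>. Each squared rank error
  then has mean at most \<open>4 / n\<close>, and there are \<open>n\<close> of them.\<close>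

lemma expectation_sum_rank_error_square_le:
  assumes "1 \<le> n"
  shows "integrable M (\<lambda>\<omega>. \<Sum>i = 1..n. (rank_error n \<omega> i)\<^sup>2)"
    and "expectation (\<lambda>\<omega>. \<Sum>i = 1..n. (rank_error n \<omega> i)\<^sup>2) \<le> 4"
proof -
  define S where "S i \<omega> = (\<Sum>j\<in>{1..n} - {i}. rank_deviation i j \<omega>)" for i \<omega>
  have S_square: "(S i \<omega>)\<^sup>2
      = (\<Sum>j\<in>{1..n} - {i}. \<Sum>l\<in>{1..n} - {i}. rank_deviation i j \<omega> * rank_deviation i l \<omega>)" for i \<omega>
    by (simp add: S_def power2_eq_square sum_product)
  have int_S: "integrable M (\<lambda>\<omega>. (S i \<omega>)\<^sup>2)" if "i \<in> {1..n}" for i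
    unfolding S_square using that
    by (intro Bochner_Integration.integrable_sum integrable_rank_deviation_mult) auto
  have exp_S: "expectation (\<lambda>\<omega>. (S i \<omega>)\<^sup>2) \<le> real n" if i: "i \<in> {1..n}" for i
  proof -
    have "expectation (\<lambda>\<omega>. (S i \<omega>)\<^sup>2) = (\<Sum>j\<in>{1..n} - {i}. \<Sum>l\<in>{1..n} - {i}.
        expectation (\<lambda>\<omega>. rank_deviation i j \<omega> * rank_deviation i l \<omega>))"
    proof -
      have int: "integrable M (\<lambda>\<omega>. rank_deviation i j \<omega> * rank_deviation i l \<omega>)"
        if "j \<in> {1..n} - {i}" "l \<in> {1..n} - {i}" for j l
        using that i by (intro integrable_rank_deviation_mult) auto
      show ?thesis
        unfolding S_square
        by (simp only: Bochner_Integration.integral_sum int Bochner_Integration.integrable_sum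
            cong: sum.cong)
    qed
    \<comment> \<open>Only the diagonal terms survive.\<close>
    also have "\<dots> = (\<Sum>j\<in>{1..n} - {i}. \<Sum>l\<in>{1..n} - {i}. if l = j then
        expectation (\<lambda>\<omega>. rank_deviation i j \<omega> * rank_deviation i j \<omega>) else 0)"
      using i by (intro sum.cong) (auto intro!: expectation_rank_deviation_mult_eq_0)
    also have "\<dots> = (\<Sum>j\<in>{1..n} - {i}.
        expectation (\<lambda>\<omega>. rank_deviation i j \<omega> * rank_deviation i j \<omega>))"
      by (intro sum.cong) (auto simp: sum.delta)
    also have "\<dots> \<le> (\<Sum>j\<in>{1..n} - {i}. 1)"
    proof (intro sum_mono)
      fix j assume j: "j \<in> {1..n} - {i}"
      have "expectation (\<lambda>\<omega>. rank_deviation i j \<omega> * rank_deviation i j \<omega>) \<le> expectation (\<lambda>_. 1)"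
      proof (intro integral_mono integrable_rank_deviation_mult)
        fix \<omega> assume "\<omega> \<in> space M"
        then show "rank_deviation i j \<omega> * rank_deviation i j \<omega> \<le> 1"
          using abs_rank_deviation_mult_le[of i \<omega> j j] i by auto
      qed (use i j in auto)
      then show "expectation (\<lambda>\<omega>. rank_deviation i j \<omega> * rank_deviation i j \<omega>) \<le> 1"
        by (simp add: prob_space)
    qed
    also have "\<dots> \<le> real n" using i by simp
    finally show ?thesis .
  qed
  have le: "(rank_error n \<omega> i)\<^sup>2 \<le> (2 + 2 * (S i \<omega>)\<^sup>2) / (real n)\<^sup>2"
    if "i \<in> {1..n}" "\<omega> \<in> space M" for i \<omega>
  proof -
    have "\<bar>1 - \<xi> i \<omega>\<bar> \<le> 1" using latent_range[of i \<omega>] that by auto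
    then have "(1 - \<xi> i \<omega>)\<^sup>2 \<le> 1" by (simp add: abs_square_le_1)
    \<comment> \<open>This square yields
      \<open>(a + b)\<^sup>2 \<le> 2 * a\<^sup>2 + 2 * b\<^sup>2\<close> for the bias
      \<open>a\<close> and the sum \<open>b\<close>.\<close>
    moreover have "0 \<le> (1 - \<xi> i \<omega> - S i \<omega>)\<^sup>2" by simp
    ultimately have "(1 - \<xi> i \<omega> + S i \<omega>)\<^sup>2 \<le> 2 + 2 * (S i \<omega>)\<^sup>2"
      by (simp add: power2_eq_square algebra_simps)
    then show ?thesis
      unfolding rank_error_eq[OF that(1)] S_def[symmetric]
      by (simp only: power_divide power2_minus) (simp add: divide_right_mono)
  qed
  have int: "integrable M (\<lambda>\<omega>. (rank_error n \<omega> i)\<^sup>2)" if i: "i \<in> {1..n}" for i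
  proof (rule Bochner_Integration.integrable_bound)
    show "integrable M (\<lambda>\<omega>. (2 + 2 * (S i \<omega>)\<^sup>2) / (real n)\<^sup>2)"
      using int_S[OF i] by simp
    show "AE \<omega> in M. norm ((rank_error n \<omega> i)\<^sup>2) \<le> norm ((2 + 2 * (S i \<omega>)\<^sup>2) / (real n)\<^sup>2)"
      using le[OF i] by (intro AE_I2) (simp add: abs_of_nonneg)
    show "(\<lambda>\<omega>. (rank_error n \<omega> i)\<^sup>2) \<in> borel_measurable M"
      using rank_error_measurable[OF i] by (rule borel_measurable_power)
  qed
  then show "integrable M (\<lambda>\<omega>. \<Sum>i = 1..n. (rank_error n \<omega> i)\<^sup>2)"
    by (intro Bochner_Integration.integrable_sum)
  have "expectation (\<lambda>\<omega>. (rank_error n \<omega> i)\<^sup>2) \<le> 4 / real n" if i: "i \<in> {1..n}" for i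
  proof -
    have "expectation (\<lambda>\<omega>. (rank_error n \<omega> i)\<^sup>2)
        \<le> expectation (\<lambda>\<omega>. (2 + 2 * (S i \<omega>)\<^sup>2) / (real n)\<^sup>2)"
      using int[OF i] int_S[OF i] le[OF i] by (intro integral_mono) simp_all
    also have "\<dots> = (2 + 2 * expectation (\<lambda>\<omega>. (S i \<omega>)\<^sup>2)) / (real n)\<^sup>2"
      using int_S[OF i] by (simp add: prob_space)
    also have "\<dots> \<le> (2 * real n + 2 * real n) / (real n)\<^sup>2"
      using exp_S[OF i] assms by (intro divide_right_mono add_mono) auto
    also have "\<dots> = 4 / real n"
      using assms by (simp add: power2_eq_square)
    finally show ?thesis .
  qed
  then have "(\<Sum>i = 1..n. expectation (\<lambda>\<omega>. (rank_error n \<omega> i)\<^sup>2)) \<le> (\<Sum>i = 1..n. 4 / real n)"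
    by (intro sum_mono)
  then show "expectation (\<lambda>\<omega>. \<Sum>i = 1..n. (rank_error n \<omega> i)\<^sup>2) \<le> 4"
    using int assms by (subst Bochner_Integration.integral_sum) auto
qed

end

section \<open>The rate for the rank assignment\<close>

context scaled_exchangeable_graph
begin

section \<open>Measurability and bounds for the edge probabilities\<close>

text \<open>The graphon is measurable only as a function on the open square, so the composition
  relies on the latent variables lying in the open interval at every
  \<open>\<omega>\<close>.\<close>

lemma edge_prob_measurable:
  assumes "1 \<le> i" "1 \<le> j"
  shows "(\<lambda>\<omega>. edge_prob f \<rho> \<xi> n \<omega> i j) \<in> borel_measurable M"
proof -
  have "(\<lambda>\<omega>. (\<xi> i \<omega>, \<xi> j \<omega>)) \<in> M \<rightarrow>\<^sub>M restrict_space borel open_unit_square"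
    using assms latent_range
    by (intro measurable_restrict_space2 borel_measurable_Pair latent_measurable) auto
  from measurable_compose[OF this graphon_measurable] show ?thesis
    unfolding edge_prob_def by simp
qed

lemma blockmodel_divergence_measurable:
  "(\<lambda>\<omega>. blockmodel_divergence n (edge_prob f \<rho> \<xi> n \<omega>) z) \<in> borel_measurable M"
proof -
  have avg: "(\<lambda>\<omega>. block_average n z (edge_prob f \<rho> \<xi> n \<omega>) a b) \<in> borel_measurable M" for a b
    unfolding block_average_def split_def
    by (intro borel_measurable_divide borel_measurable_sum edge_prob_measurable borel_measurable_const)
      (use in_block_pairsD(1,2) in fastforce)+
  show ?thesis
    unfolding blockmodel_divergence_def bernoulli_KL_def split_def
    by (intro borel_measurable_sum borel_measurable_add borel_measurable_times borel_measurable_diff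
        borel_measurable_const borel_measurable_ln borel_measurable_divide avg edge_prob_measurable)
      (auto simp: vertex_pairs_def)
qed

lemma edge_prob_sum_measurable:
  "(\<lambda>\<omega>. \<Sum>(i, j)\<in>vertex_pairs n. edge_prob f \<rho> \<xi> n \<omega> i j) \<in> borel_measurable M"
  unfolding split_def
  by (intro borel_measurable_sum edge_prob_measurable) (auto simp: vertex_pairs_def)

lemma Min_blockmodel_divergence_measurable:
  assumes "finite Z"
  shows "(\<lambda>\<omega>. Min (blockmodel_divergence n (edge_prob f \<rho> \<xi> n \<omega>) ` Z)) \<in> borel_measurable M"
  using assms by (intro borel_measurable_Min blockmodel_divergence_measurable)

lemma latent_pair_in: "\<omega> \<in> space M \<Longrightarrow> 1 \<le> i \<Longrightarrow> 1 \<le> j \<Longrightarrow> (\<xi> i \<omega>, \<xi> j \<omega>) \<in> open_unit_square"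
  using latent_range by simp

lemma edge_prob_bounds:
  assumes "\<forall>v\<in>open_unit_square. c \<le> f v" "\<forall>v\<in>open_unit_square. \<rho> n * f v \<le> u"
    and "1 \<le> n" "\<omega> \<in> space M" "1 \<le> i" "1 \<le> j"
  shows "\<rho> n * c \<le> edge_prob f \<rho> \<xi> n \<omega> i j" "edge_prob f \<rho> \<xi> n \<omega> i j \<le> u"
  using assms latent_pair_in[of \<omega> i j] scale_pos[of n] by (auto simp: edge_prob_def)

text \<open>For \<open>n \<ge> 2\<close> there are
  \<open>n * (n - 1) / 2 \<ge> n\<^sup>2 / 4\<close> vertex pairs, each contributing at least
  \<open>\<rho> n * c\<close>.\<close>

lemma edge_prob_sum_ge:
  assumes c: "0 < c" "\<forall>v\<in>open_unit_square. c \<le> f v" and n: "2 \<le> n" and \<omega>: "\<omega> \<in> space M"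
  shows "\<rho> n * c * (real n)\<^sup>2 / 4 \<le> (\<Sum>(i, j)\<in>vertex_pairs n. edge_prob f \<rho> \<xi> n \<omega> i j)"
proof -
  have rc: "0 < \<rho> n * c" using scale_pos[of n] n c by simp
  have "n * n \<le> 4 * card (vertex_pairs n)"
  proof -
    have "n \<le> 2 * (n - 1)" using n by simp
    then have "n * n \<le> n * (2 * (n - 1))" by (rule mult_le_mono2)
    then show ?thesis using card_vertex_pairs[of n] by (simp only: mult.left_commute[of n 2] mult.assoc[symmetric])
  qed
  then have "real (n * n) \<le> real (4 * card (vertex_pairs n))"
    by (rule of_nat_mono)
  then have "\<rho> n * c * ((real n)\<^sup>2 / 4) \<le> \<rho> n * c * real (card (vertex_pairs n))"
    using rc by (intro mult_left_mono) (auto simp: power2_eq_square)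
  also have "\<dots> = real (card (vertex_pairs n)) * (\<rho> n * c)"
    by simp
  also have "\<dots> \<le> (\<Sum>(i, j)\<in>vertex_pairs n. edge_prob f \<rho> \<xi> n \<omega> i j)"
  proof (intro sum_bounded_below, clarify)
    fix i j assume "(i, j) \<in> vertex_pairs n"
    then have "c \<le> f (\<xi> i \<omega>, \<xi> j \<omega>)"
      using c(2) latent_pair_in[OF \<omega>, of i j] by (auto simp: vertex_pairs_def)
    then show "\<rho> n * c \<le> edge_prob f \<rho> \<xi> n \<omega> i j"
      using scale_pos[of n] n by (simp add: edge_prob_def)
  qed
  finally show ?thesis by simp
qed

text \<open>A bound for each fixed \<open>\<omega>\<close>, with block constants
  \<open>\<rho> n * f (y a, y b)\<close> at the centres \<open>y\<close>. Squared deviations carry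
  \<open>(\<rho> n)\<^sup>2\<close> and the chi-square denominator only one \<open>\<rho> n\<close>;
  the remaining factor will cancel against the edge sum.\<close>

lemma blockmodel_divergence_rank_assignment_le:
  assumes alpha: "0 < \<alpha>" "\<alpha> \<le> 1"
    and L: "\<forall>u\<in>open_unit_square. \<forall>v\<in>open_unit_square. \<bar>f u - f v\<bar> \<le> L * dist u v powr \<alpha>"
    and c: "0 < c" "\<forall>v\<in>open_unit_square. c \<le> f v"
    and \<delta>: "0 < \<delta>" "\<forall>v\<in>open_unit_square. \<rho> n * f v \<le> 1 - \<delta>"
    and n: "1 \<le> n" and \<omega>: "\<omega> \<in> space M" and z: "z \<in> assignments n k"
    and m: "\<And>a. a \<in> {1..k} \<Longrightarrow> community_size n z a \<le> m"
  shows "blockmodel_divergence n (edge_prob f \<rho> \<xi> n \<omega>)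
      (permuted_assignment n k (community_size n z) (sample_rank n (\<lambda>j. \<xi> j \<omega>)))
    \<le> \<rho> n * (32 * L\<^sup>2 / (c * \<delta>)) * (real n)\<^sup>2 *
       (real n powr (- \<alpha>) * (1 + (\<Sum>i = 1..n. (rank_error n \<omega> i)\<^sup>2))
         + (real m / real n) powr (2 * \<alpha>))"
    (is "blockmodel_divergence n ?p ?z \<le> _")
proof -
  let ?e = "\<lambda>i. \<bar>rank_error n \<omega> i\<bar>" and ?w = "real m / real n"
  let ?W = "\<Sum>i = 1..n. (rank_error n \<omega> i)\<^sup>2"
  have r: "0 < \<rho> n" using scale_pos n by simp
  obtain y :: "nat \<Rightarrow> real" where z_range: "?z \<in> {1..n} \<rightarrow> {1..k}"
    and y_range: "\<And>a. a \<in> {1..k} \<Longrightarrow> y a \<in> {0<..<1}"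
    and y: "\<And>i. i \<in> {1..n} \<Longrightarrow>
      \<bar>real (sample_rank n (\<lambda>j. \<xi> j \<omega>) i) / real n - y (?z i)\<bar> \<le> ?w"
    using permuted_assignment_centres[OF z sample_rank_permutes m] by metis
  have near: "\<bar>\<xi> i \<omega> - y (?z i)\<bar> \<le> ?e i + ?w" if "i \<in> {1..n}" for i
    using y[OF that] unfolding rank_error_def by linarith
  have le: "(?p i j - \<rho> n * f (y (?z i), y (?z j)))\<^sup>2
      \<le> (\<rho> n)\<^sup>2 * L\<^sup>2 * (16 * (?e i powr (2 * \<alpha>) + ?e j powr (2 * \<alpha>) + ?w powr (2 * \<alpha>)))"
    if i: "i \<in> {1..n}" and j: "j \<in> {1..n}" for i j
  proof -
    let ?u = "(\<xi> i \<omega>, \<xi> j \<omega>)" and ?v = "(y (?z i), y (?z j))"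
    have u: "?u \<in> open_unit_square" using i j \<omega> by (intro latent_pair_in) auto
    have "?z i \<in> {1..k}" "?z j \<in> {1..k}" using z_range i j by (auto simp: Pi_iff)
    then have v: "?v \<in> open_unit_square" using y_range by blast
    have "dist ?u ?v \<le> \<bar>\<xi> i \<omega> - y (?z i)\<bar> + \<bar>\<xi> j \<omega> - y (?z j)\<bar>"
      using dist_Pair_le[of "\<xi> i \<omega>" "\<xi> j \<omega>" "y (?z i)" "y (?z j)"] by (simp only: dist_real_def)
    then have d: "dist ?u ?v \<le> ?e i + ?e j + 2 * ?w"
      using near[OF i] near[OF j] by linarith
    have "(f ?u - f ?v)\<^sup>2 = \<bar>f ?u - f ?v\<bar>\<^sup>2" by simp
    also have "\<dots> \<le> (L * dist ?u ?v powr \<alpha>)\<^sup>2"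
      using L u v by (intro power_mono) auto
    also have "\<dots> = L\<^sup>2 * dist ?u ?v powr (2 * \<alpha>)"
      by (simp only: power_mult_distrib power2_eq_square[of "_ powr _"] powr_add[symmetric] mult_2)
    also have "\<dots> \<le> L\<^sup>2 * (?e i + ?e j + 2 * ?w) powr (2 * \<alpha>)"
      using d alpha by (intro mult_left_mono powr_mono2) auto
    also have "\<dots> \<le> L\<^sup>2 * (16 * (?e i powr (2 * \<alpha>) + ?e j powr (2 * \<alpha>) + ?w powr (2 * \<alpha>)))"
      using alpha by (intro mult_left_mono powr_sum_le) auto
    finally have "(\<rho> n)\<^sup>2 * (f ?u - f ?v)\<^sup>2
        \<le> (\<rho> n)\<^sup>2 * (L\<^sup>2 * (16 * (?e i powr (2 * \<alpha>) + ?e j powr (2 * \<alpha>) + ?w powr (2 * \<alpha>))))"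
      by (intro mult_left_mono) auto
    moreover have "(?p i j - \<rho> n * f ?v)\<^sup>2 = (\<rho> n)\<^sup>2 * (f ?u - f ?v)\<^sup>2"
      by (simp only: edge_prob_def right_diff_distrib[symmetric] power_mult_distrib)
    ultimately show ?thesis by (simp only: mult.assoc)
  qed
  \<comment> \<open>The choice \<open>s = n\<close> in \<open>abs_powr_le_scaled\<close> balances
    its two terms: the sum of squared rank errors has bounded mean.\<close>
  have e_sum: "(\<Sum>i = 1..n. ?e i powr (2 * \<alpha>)) \<le> real n * (real n powr (- \<alpha>) * (1 + ?W))"
  proof -
    have "(\<Sum>i = 1..n. ?e i powr (2 * \<alpha>))
        \<le> (\<Sum>i = 1..n. real n powr (- \<alpha>) * (1 + real n * (rank_error n \<omega> i)\<^sup>2))"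
      using n alpha by (intro sum_mono abs_powr_le_scaled) auto
    also have "\<dots> = real n powr (- \<alpha>) * (real n + real n * ?W)"
      by (simp only: sum_distrib_left[symmetric] sum.distrib) simp
    also have "\<dots> = real n * (real n powr (- \<alpha>) * (1 + ?W))"
      by (simp only: distrib_left) simp
    finally show ?thesis .
  qed
  have "blockmodel_divergence n ?p ?z
      \<le> (\<Sum>i\<in>{1..n}. \<Sum>j\<in>{1..n}. (?p i j - \<rho> n * f (y (?z i), y (?z j)))\<^sup>2) / (\<rho> n * c * \<delta>)"
  proof (rule blockmodel_divergence_le[OF _ _ \<delta>(1) z_range])
    show "\<rho> n * c \<le> ?p i j \<and> ?p i j \<le> 1 - \<delta>" if "i \<in> {1..n}" "j \<in> {1..n}" for i j
      using edge_prob_bounds[OF c(2) \<delta>(2) n \<omega>] that by simp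
  qed (use r c in simp)
  also have "\<dots> \<le> (\<Sum>i\<in>{1..n}. \<Sum>j\<in>{1..n}. (\<rho> n)\<^sup>2 * L\<^sup>2 *
      (16 * (?e i powr (2 * \<alpha>) + ?e j powr (2 * \<alpha>) + ?w powr (2 * \<alpha>)))) / (\<rho> n * c * \<delta>)"
    using r c \<delta> by (intro divide_right_mono sum_mono le) auto
  \<comment> \<open>By symmetry the terms in \<open>i\<close> and in \<open>j\<close> have the same
    double sum, hence the factor \<open>2 * real n\<close>.\<close>
  also have "(\<Sum>i\<in>{1..n}. \<Sum>j\<in>{1..n}. (\<rho> n)\<^sup>2 * L\<^sup>2 *
      (16 * (?e i powr (2 * \<alpha>) + ?e j powr (2 * \<alpha>) + ?w powr (2 * \<alpha>))))
      = (\<rho> n)\<^sup>2 * L\<^sup>2 * (16 * (2 * real n * (\<Sum>i = 1..n. ?e i powr (2 * \<alpha>))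
          + (real n)\<^sup>2 * ?w powr (2 * \<alpha>)))"
    by (simp only: sum_distrib_left[symmetric] sum.distrib sum_constant card_atLeastAtMost)
      (simp add: power2_eq_square algebra_simps)
  \<comment> \<open>The width term is doubled merely to share the factor \<open>32 = 16 * 2\<close>
    with the rank errors.\<close>
  also have "\<dots> / (\<rho> n * c * \<delta>) \<le> (\<rho> n)\<^sup>2 * L\<^sup>2 * (16 * (2 * real n *
      (real n * (real n powr (- \<alpha>) * (1 + ?W))) + 2 * ((real n)\<^sup>2 * ?w powr (2 * \<alpha>)))) / (\<rho> n * c * \<delta>)"
  proof -
    have "(real n)\<^sup>2 * ?w powr (2 * \<alpha>) \<le> 2 * ((real n)\<^sup>2 * ?w powr (2 * \<alpha>))"
      by simp
    then show ?thesis
      using r c \<delta> e_sum by (intro divide_right_mono mult_left_mono add_mono) auto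
  qed
  also have "\<dots> = \<rho> n * (32 * L\<^sup>2 / (c * \<delta>)) * (real n)\<^sup>2 *
      (real n powr (- \<alpha>) * (1 + ?W) + ?w powr (2 * \<alpha>))"
  proof -
    have "R\<^sup>2 * L\<^sup>2 * (16 * (2 * N * (N * A) + 2 * (N\<^sup>2 * B))) / (R * c * \<delta>)
        = R * (32 * L\<^sup>2 / (c * \<delta>)) * N\<^sup>2 * (A + B)" if "R > 0" for R N A B :: real
      using that c(1) \<delta>(1) by (simp add: divide_simps) (simp add: power2_eq_square algebra_simps)
    from this[OF r] show ?thesis .
  qed
  finally show ?thesis .
qed

end

section \<open>From the rank assignment to a rate in probability\<close>

theorem theorem6p1:
  fixes M :: "'a measure"
    and f :: "real \<times> real \<Rightarrow> real"
    and \<rho> :: "nat \<Rightarrow> real"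
    and \<xi> :: "nat \<Rightarrow> 'a \<Rightarrow> real"
    and \<alpha> :: real
    and k :: "nat \<Rightarrow> nat"
    and Z :: "nat \<Rightarrow> (nat \<Rightarrow> nat) set"
  assumes model: "scaled_exchangeable_graph M f \<rho> \<xi>"
    and f_pos: "\<forall>v\<in>open_unit_square. 0 < f v"
    and alpha: "0 < \<alpha>" "\<alpha> \<le> 1"
    and f_holder: "holder_on \<alpha> open_unit_square f"
    and f_away_zero: "\<exists>c>0. \<forall>v\<in>open_unit_square. c \<le> f v"
    and away_one: "\<exists>\<delta>>0. \<forall>n\<ge>1. \<forall>v\<in>open_unit_square. \<rho> n * f v \<le> 1 - \<delta>"
    and Z_admissible: "\<forall>n. Z n \<subseteq> assignments n (k n)"
    and Z_nonempty: "\<forall>\<^sub>F n in sequentially. Z n \<noteq> {}"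
    and Z_closed: "\<forall>n. \<forall>z\<in>Z n. \<forall>\<pi>. \<pi> permutes {1..n} \<longrightarrow>
          permuted_assignment n (k n) (community_size n z) \<pi> \<in> Z n"
  shows "big_O_P M
      (\<lambda>n \<omega>. Min (blockmodel_divergence n (edge_prob f \<rho> \<xi> n \<omega>) ` Z n)
               / (\<Sum>(i, j)\<in>vertex_pairs n. edge_prob f \<rho> \<xi> n \<omega> i j))
      (\<lambda>n. real n powr (- \<alpha>)
            + (real n / real (largest_community n (k n) (Z n))) powr (- 2 * \<alpha>))"
    (is "big_O_P M ?X ?r")
proof -
  interpret scaled_exchangeable_graph M f \<rho> \<xi> by (rule model)
  obtain c where c: "0 < c" "\<forall>v\<in>open_unit_square. c \<le> f v"
    using f_away_zero by blast
  obtain \<delta> where \<delta>: "0 < \<delta>" "\<forall>n\<ge>1. \<forall>v\<in>open_unit_square. \<rho> n * f v \<le> 1 - \<delta>"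
    using away_one by blast
  obtain L where L: "\<forall>u\<in>open_unit_square. \<forall>v\<in>open_unit_square. \<bar>f u - f v\<bar> \<le> L * dist u v powr \<alpha>"
    using f_holder unfolding holder_on_def by blast
  have fin: "finite (Z n)" for n
    using Z_admissible finite_assignments finite_subset by metis
  define W where "W n \<omega> = (\<Sum>i = 1..n. (rank_error n \<omega> i)\<^sup>2)" for n \<omega>
  \<comment> \<open>Here \<open>128 = 32 * 4\<close> combines the constant for the rank assignment
    with the \<open>4\<close> from the edge sum, which also supplies the second factor
    \<open>c\<close>. The summand \<open>1\<close> keeps \<open>K\<close> positive when
    \<open>L = 0\<close>.\<close>
  define K where "K = 128 * L\<^sup>2 / (c\<^sup>2 * \<delta>) + 1"
  have K: "0 < K" using c \<delta> by (auto simp: K_def intro!: add_nonneg_pos)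
  have W_nonneg: "0 \<le> W n \<omega>" for n \<omega>
    unfolding W_def by (intro sum_nonneg) auto
  have X_measurable: "?X n \<in> borel_measurable M" for n
    using fin by (intro borel_measurable_divide Min_blockmodel_divergence_measurable
        edge_prob_sum_measurable)
  \<comment> \<open>All randomness of the bound is confined to \<open>W n \<omega>\<close>, whose
    mean is at most \<open>4\<close>.\<close>
  have bound: "\<bar>?X n \<omega>\<bar> \<le> K * (1 + W n \<omega>) * \<bar>?r n\<bar>"
    if n: "2 \<le> n" "Z n \<noteq> {}" and \<omega>: "\<omega> \<in> space M" for n \<omega>
  proof -
    let ?p = "edge_prob f \<rho> \<xi> n \<omega>" and ?m = "largest_community n (k n) (Z n)"
    let ?s = "\<Sum>(i, j)\<in>vertex_pairs n. ?p i j"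
    have n1: "1 \<le> n" using n by simp
    have r: "0 < \<rho> n" using scale_pos n1 .
    \<comment> \<open>Any admissible \<open>z\<close> will do, as only its community sizes are used.
      Closure under permutations puts the rank assignment \<open>z'\<close> into \<open>Z n\<close>,
      so the minimum is at most its divergence.\<close>
    obtain z where z: "z \<in> Z n" using n by blast
    define z' where "z' = permuted_assignment n (k n) (community_size n z) (sample_rank n (\<lambda>j. \<xi> j \<omega>))"
    have z': "z' \<in> Z n"
      unfolding z'_def using Z_closed z sample_rank_permutes by blast
    define R where "R = real n powr (- \<alpha>) * (1 + W n \<omega>) + (real ?m / real n) powr (2 * \<alpha>)"
    have bounds: "\<rho> n * c \<le> ?p i j \<and> ?p i j \<le> 1 - \<delta>" if "i \<in> {1..n}" "j \<in> {1..n}" for i j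
      using edge_prob_bounds[OF c(2) \<delta>(2)[rule_format, OF n1, THEN ballI] n1 \<omega>] that by simp
    have s: "\<rho> n * c * (real n)\<^sup>2 / 4 \<le> ?s"
      by (rule edge_prob_sum_ge[OF c n(1) \<omega>])
    have pos: "0 < \<rho> n * c * (real n)\<^sup>2 / 4" using r c n by simp
    have R: "0 \<le> R" unfolding R_def using W_nonneg[of n \<omega>] by simp
    have "0 \<le> blockmodel_divergence n ?p z''" for z''
      by (rule blockmodel_divergence_nonneg[of n "\<rho> n * c" ?p "1 - \<delta>"])
        (use bounds r c \<delta> in auto)
    then have "0 \<le> Min (blockmodel_divergence n ?p ` Z n)"
      using fin n by (subst Min_ge_iff) auto
    then have "\<bar>?X n \<omega>\<bar> = Min (blockmodel_divergence n ?p ` Z n) / ?s"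
      using s pos by simp
    also have "\<dots> \<le> blockmodel_divergence n ?p z' / ?s"
      using fin z' s pos by (intro divide_right_mono Min_le) auto
    also have "\<dots> \<le> \<rho> n * (32 * L\<^sup>2 / (c * \<delta>)) * (real n)\<^sup>2 * R / ?s"
    proof (rule divide_right_mono)
      show "blockmodel_divergence n ?p z' \<le> \<rho> n * (32 * L\<^sup>2 / (c * \<delta>)) * (real n)\<^sup>2 * R"
        unfolding z'_def R_def W_def
        using Z_admissible z \<delta> n1 by (intro blockmodel_divergence_rank_assignment_le alpha L c \<omega>
          community_size_le_largest) auto
    qed (use s pos in linarith)
    also have "\<dots> \<le> \<rho> n * (32 * L\<^sup>2 / (c * \<delta>)) * (real n)\<^sup>2 * R / (\<rho> n * c * (real n)\<^sup>2 / 4)"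
      using s pos r c \<delta> R by (intro divide_left_mono mult_nonneg_nonneg mult_pos_pos) auto
    also have "\<dots> = 128 * L\<^sup>2 / (c\<^sup>2 * \<delta>) * R"
      using r c \<delta> n by (simp add: field_simps power2_eq_square)
    also have "\<dots> \<le> K * R"
      using R by (intro mult_right_mono) (auto simp: K_def)
    \<comment> \<open>Since \<open>W n \<omega>\<close> is nonnegative, the width term may be
      multiplied by \<open>1 + W n \<omega>\<close> as well.\<close>
    also have "R \<le> (1 + W n \<omega>) * ?r n"
    proof -
      have "(real ?m / real n) powr (2 * \<alpha>) = (real n / real ?m) powr (- 2 * \<alpha>)"
        using n by (simp add: powr_divide powr_minus_divide)
      moreover have "0 \<le> W n \<omega> * (real n / real ?m) powr (- 2 * \<alpha>)"
        using W_nonneg[of n \<omega>] by simp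
      ultimately show ?thesis
        by (simp add: R_def algebra_simps)
    qed
    finally show ?thesis using K by (simp add: mult_ac)
  qed
  have tail: "\<exists>C>0. \<forall>\<^sub>F n in sequentially. prob {\<omega> \<in> space M. \<bar>?X n \<omega>\<bar> > C * \<bar>?r n\<bar>} \<le> \<epsilon>"
    if \<epsilon>: "0 < \<epsilon>" for \<epsilon>
  proof (intro exI conjI)
    \<comment> \<open>The witness comes from Markov's inequality at level
      \<open>4 / \<epsilon>\<close>: exceeding the bound forces \<open>W n \<omega>\<close> above
      that level, which has probability at most
      \<open>4 / (4 / \<epsilon>) = \<epsilon>\<close>.\<close>
    show "0 < K * (1 + 4 / \<epsilon>)" using K \<epsilon> by (simp add: add_pos_pos)
    have le: "prob {\<omega> \<in> space M. \<bar>?X n \<omega>\<bar> > K * (1 + 4 / \<epsilon>) * \<bar>?r n\<bar>} \<le> \<epsilon>"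
      if n: "2 \<le> n" "Z n \<noteq> {}" for n
    proof -
      have n1: "1 \<le> n" using n by simp
      have int: "integrable M (W n)" and E: "expectation (W n) \<le> 4"
        using expectation_sum_rank_error_square_le[OF n1] by (simp_all add: W_def[abs_def])
      have "{\<omega> \<in> space M. \<bar>?X n \<omega>\<bar> > K * (1 + 4 / \<epsilon>) * \<bar>?r n\<bar>} \<subseteq> {\<omega> \<in> space M. W n \<omega> \<ge> 4 / \<epsilon>}"
      proof safe
        fix \<omega> assume \<omega>: "\<omega> \<in> space M" "\<bar>?X n \<omega>\<bar> > K * (1 + 4 / \<epsilon>) * \<bar>?r n\<bar>"
        then have "K * (1 + 4 / \<epsilon>) * \<bar>?r n\<bar> < K * (1 + W n \<omega>) * \<bar>?r n\<bar>"
          using bound[OF n \<omega>(1)] by linarith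
        then have "K * (1 + 4 / \<epsilon>) < K * (1 + W n \<omega>)"
          by (rule mult_right_less_imp_less) simp
        then show "4 / \<epsilon> \<le> W n \<omega>" using K by simp
      qed
      moreover have "{\<omega> \<in> space M. W n \<omega> \<ge> 4 / \<epsilon>} \<in> events"
        using borel_measurable_integrable[OF int] by measurable
      ultimately have "prob {\<omega> \<in> space M. \<bar>?X n \<omega>\<bar> > K * (1 + 4 / \<epsilon>) * \<bar>?r n\<bar>}
          \<le> prob {\<omega> \<in> space M. W n \<omega> \<ge> 4 / \<epsilon>}"
        by (rule finite_measure_mono)
      also have "\<dots> \<le> expectation (W n) / (4 / \<epsilon>)"
        using int W_nonneg \<epsilon> by (intro integral_Markov_inequality_measure[where A = "{}"]) auto
      also have "\<dots> \<le> 4 / (4 / \<epsilon>)"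
        using E \<epsilon> by (intro divide_right_mono) auto
      finally show ?thesis using \<epsilon> by simp
    qed
    show "\<forall>\<^sub>F n in sequentially. prob {\<omega> \<in> space M. \<bar>?X n \<omega>\<bar> > K * (1 + 4 / \<epsilon>) * \<bar>?r n\<bar>} \<le> \<epsilon>"
      using Z_nonempty eventually_ge_at_top[of 2] by eventually_elim (rule le)
  qed
  show ?thesis
    unfolding big_O_P_def using X_measurable tail by blast
qed

end
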